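(* Let $s,t$ be positive integers and define sequences $(A_n)_{n\ge 0}$, $(B_n)_{n\ge 0}$ of nonnegative integers by $$A_n=\operatorname{mex}\{A_i,B_i:0\le i<n\},\qquad B_n=sA_n+tn\qquad(n\ge 0).$$ Then there exist real numbers $\alpha,\gamma,\beta,\delta$ such that $A_n=\lfloor n\alpha+\gamma\rfloor$ and $B_n=\lfloor n\beta+\delta\rfloor$ for all integers $n\ge 0$ if and only if $s=1$.
   Context: For a finite set $S$ of nonnegative integers, $\operatorname{mex} S$ denotes the least nonnegative integer not in $S$ (so $\operatorname{mex}\emptyset=0$). *)

theory Defs
  imports Complex_Main
begin

definition mex :: "nat set \<Rightarrow> nat" where
  "mex S = (LEAST k. k \<notin> S)"

text \<open>The recursion for \<open>A\<close> with \<open>B i = s * A i + t * i\<close> unfolded, so that only \<open>A\<close> is recursive;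
  \<open>seqA_eq\<close> and \<open>seqB_def\<close> below are the defining equations in their usual mutual form.\<close>

function seqA :: "nat \<Rightarrow> nat \<Rightarrow> nat \<Rightarrow> nat" where
  "seqA s t n = mex ((\<Union>i\<in>{..<n}. {seqA s t i, s * seqA s t i + t * i}))"
  by auto
termination by (relation "measure (\<lambda>(s, t, n). n)") auto

declare seqA.simps [simp del]

definition seqB :: "nat \<Rightarrow> nat \<Rightarrow> nat \<Rightarrow> nat" where
  "seqB s t n = s * seqA s t n + t * n"

lemma seqA_eq: "seqA s t n = mex ({seqA s t i | i. i < n} \<union> {seqB s t i | i. i < n})"
proof -
  have "(\<Union>i\<in>{..<n}. {seqA s t i, s * seqA s t i + t * i}) =
        {seqA s t i | i. i < n} \<union> {seqB s t i | i. i < n}"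
    by (auto simp: seqB_def)
  then show ?thesis
    by (subst seqA.simps) simp
qed

end

theory Submission
  imports Defs
begin

text \<open>If \<open>B\<^sub>n = \<lfloor>n\<beta> + \<delta>\<rfloor>\<close>, then \<open>n(\<beta> - t) + \<delta> - s A\<^sub>n\<close> lies in \<open>[0, 1)\<close> for all \<open>n\<close>, so any two
  increments \<open>A\<^sub>n\<^sub>+\<^sub>1 - A\<^sub>n\<close> differ by less than \<open>2/s\<close>. For \<open>s \<ge> 2\<close> they all equal
  \<open>A\<^sub>1 - A\<^sub>0 = 1\<close>, whence \<open>A\<^sub>n = n\<close>, and the value \<open>s + t\<close> is both \<open>B\<^sub>1\<close> and \<open>A\<^sub>s\<^sub>+\<^sub>t\<close>,
  which the mex rule forbids. For \<open>s = 1\<close> the positive root \<open>\<alpha>\<close> of \<open>x\<^sup>2 + (t - 2)x - t\<close>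
  is irrational and satisfies \<open>1/\<alpha> + 1/(\<alpha> + t) = 1\<close>, so by Beatty's theorem the sequences
  \<open>\<lfloor>n\<alpha>\<rfloor>\<close> and \<open>\<lfloor>n(\<alpha> + t)\<rfloor>\<close> partition the positive integers and hence obey the mex recursion.\<close>

section \<open>The mex rule and the first values\<close>

lemma mex_eqI:
  assumes "k \<notin> S" and "\<And>j. j < k \<Longrightarrow> j \<in> S"
  shows "mex S = k"
  unfolding mex_def using assms by (intro Least_equality) (auto simp: not_less[symmetric])

lemma mex_notin:
  assumes "finite S"
  shows "mex S \<notin> S"
  unfolding mex_def using ex_new_if_finite[OF infinite_UNIV_nat assms] by (rule LeastI_ex)

lemma seqA_0: "seqA s t 0 = 0"
  by (subst seqA_eq) (auto intro: mex_eqI)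

lemma seqA_1: "seqA s t 1 = 1"
  by (subst seqA_eq) (auto intro!: mex_eqI simp: seqA_0 seqB_def)

lemma seqA_neq_seqB:
  assumes "i < n"
  shows "seqA s t n \<noteq> seqB s t i"
proof -
  let ?S = "{seqA s t i | i. i < n} \<union> {seqB s t i | i. i < n}"
  have "mex ?S \<notin> ?S"
    by (rule mex_notin) auto
  then show ?thesis
    using assms unfolding seqA_eq[of s t n, symmetric] by blast
qed

section \<open>The case s \<ge> 2\<close>

lemma seqB_not_floor_linear:
  fixes \<beta> \<delta> :: real
  assumes "s \<ge> 2"
  shows "\<exists>n. int (seqB s t n) \<noteq> \<lfloor>real n * \<beta> + \<delta>\<rfloor>"
proof (rule ccontr)
  assume "\<not> ?thesis"
  then have B: "\<And>n. int (seqB s t n) = \<lfloor>real n * \<beta> + \<delta>\<rfloor>"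
    by blast
  \<comment> \<open>Since B_n = s A_n + t n, \<open>y n\<close> is the fractional part of n\<beta> +
    \<delta>.\<close>
  define y where "y n = real n * (\<beta> - real t) + \<delta> - real s * real (seqA s t n)" for n
  define d where "d n = int (seqA s t (Suc n)) - int (seqA s t n)" for n
  have y: "0 \<le> y n" "y n < 1" for n
  proof -
    have "real_of_int (int (seqB s t n)) \<le> real n * \<beta> + \<delta>"
         "real n * \<beta> + \<delta> < real_of_int (int (seqB s t n)) + 1"
      unfolding B by linarith+
    then show "0 \<le> y n" "y n < 1"
      by (auto simp: y_def seqB_def algebra_simps)
  qed
  have step: "y (Suc n) - y n = (\<beta> - real t) - real s * of_int (d n)" for n
    by (simp add: y_def d_def algebra_simps)
  have "d n = d 0" for n
  proof (rule ccontr)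
    assume "d n \<noteq> d 0"
    then have "1 \<le> \<bar>d n - d 0\<bar>" by linarith
    then have "2 * 1 \<le> int s * \<bar>d n - d 0\<bar>"
      using assms by (intro mult_mono) auto
    then have "2 \<le> real_of_int (int s * \<bar>d n - d 0\<bar>)" by linarith
    also have "\<dots> = \<bar>real s * of_int (d n) - real s * of_int (d 0)\<bar>"
      by (simp add: abs_mult flip: right_diff_distrib)
    \<comment> \<open>Differences of consecutive \<open>y\<close> values lie in (-1, 1), so two such
      differences are less than 2 apart.\<close>
    also have "\<dots> < 2"
      using step[of n] step[of 0] y[of n] y[of "Suc n"] y[of 0] y[of "Suc 0"] by linarith
    finally show False by simp
  qed
  moreover have "d 0 = 1"
    using seqA_0[of s t] seqA_1[of s t] by (simp add: d_def)
  ultimately have inc: "seqA s t (Suc n) = Suc (seqA s t n)" for n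
    unfolding d_def by (metis add.commute diff_eq_eq of_nat_Suc of_nat_eq_iff)
  have A: "seqA s t n = n" for n
    by (induction n) (auto simp: seqA_0 inc)
  show False
    using seqA_neq_seqB[of 1 "s + t" s t] assms by (simp add: A seqB_def)
qed

section \<open>Beatty's theorem\<close>

text \<open>For a common value k, divide the bounds k and k + 1 by \<alpha> and by \<beta> and add:
  the integer n + m falls strictly between k and k + 1. The lower bound is strict because n\<alpha>
  is not an integer.\<close>

lemma beatty_disjoint:
  fixes \<alpha> \<beta> :: real and n m :: nat
  assumes "\<alpha> > 0" "\<beta> > 0" and inv: "1 / \<alpha> + 1 / \<beta> = 1"
    and irrat: "\<And>k::int. real n * \<alpha> \<noteq> of_int k"
  shows "\<lfloor>real n * \<alpha>\<rfloor> \<noteq> \<lfloor>real m * \<beta>\<rfloor>"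
proof
  assume eq: "\<lfloor>real n * \<alpha>\<rfloor> = \<lfloor>real m * \<beta>\<rfloor>"
  define k where "k = \<lfloor>real n * \<alpha>\<rfloor>"
  have "of_int k \<le> real n * \<alpha>" "real n * \<alpha> < of_int k + 1"
    unfolding k_def by linarith+
  then have n: "of_int k / \<alpha> < n" "n < (of_int k + 1) / \<alpha>"
    using assms(1) irrat[of k] by (auto simp: field_simps)
  have "of_int k \<le> real m * \<beta>" "real m * \<beta> < of_int k + 1"
    unfolding k_def eq by linarith+
  then have m: "of_int k / \<beta> \<le> m" "m < (of_int k + 1) / \<beta>"
    using assms(2) by (auto simp: field_simps)
  have split: "x / \<alpha> + x / \<beta> = x" for x
    using arg_cong[OF inv, of "\<lambda>z. x * z"] by (simp add: distrib_left)
  have "of_int k < real n + real m" "real n + real m < of_int k + 1"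
    using n m split[of "of_int k"] split[of "of_int k + 1"] by linarith+
  then have "k < int n + int m" "int n + int m < k + 1"
    by linarith+
  then show False by linarith
qed

lemma floor_multiple_gap:
  fixes \<alpha> :: real and k :: nat
  assumes "\<alpha> > 0" and "k > 0" and "\<And>n::nat. \<lfloor>real n * \<alpha>\<rfloor> \<noteq> int k"
  obtains n :: nat where "real n * \<alpha> < k" and "real (Suc n) * \<alpha> \<ge> real k + 1"
proof -
  \<comment> \<open>\<open>Suc n\<close> is the index of the first multiple to reach k; as its floor
    is not k, it even reaches k + 1.\<close>
  define n where "n = (LEAST n. real (Suc n) * \<alpha> \<ge> k)"
  obtain N :: nat where "real k / \<alpha> < N"
    using reals_Archimedean2 by blast
  then have "real (Suc N) * \<alpha> \<ge> k"
    using assms(1) by (simp add: field_simps)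
  then have up: "real (Suc n) * \<alpha> \<ge> k"
    unfolding n_def by (rule LeastI)
  have "real n * \<alpha> < k"
  proof (cases n)
    case 0
    then show ?thesis using assms(2) by simp
  next
    case (Suc m)
    then have "\<not> real (Suc m) * \<alpha> \<ge> k"
      unfolding n_def by (intro not_less_Least) simp
    then show ?thesis using Suc by simp
  qed
  moreover have "real (Suc n) * \<alpha> \<ge> real k + 1"
  proof -
    have "\<lfloor>real (Suc n) * \<alpha>\<rfloor> \<ge> int k"
      using up by (simp only: le_floor_iff of_int_of_nat_eq)
    then have "\<lfloor>real (Suc n) * \<alpha>\<rfloor> \<ge> int k + 1"
      using assms(3)[of "Suc n"] by linarith
    then show ?thesis by linarith
  qed
  ultimately show ?thesis by (rule that)
qed

text \<open>If both sequences jump over k, say after n and after m, dividing by \<alpha> and \<beta>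
  and adding gives k - 1 < n + m < k, impossible for integers.\<close>

lemma beatty_cover:
  fixes \<alpha> \<beta> :: real and k :: nat
  assumes "\<alpha> > 0" "\<beta> > 0" and inv: "1 / \<alpha> + 1 / \<beta> = 1"
    and irrat: "\<And>(n::nat) (k::int). n > 0 \<Longrightarrow> real n * \<alpha> \<noteq> of_int k"
  shows "\<exists>n::nat. int k = \<lfloor>real n * \<alpha>\<rfloor> \<or> int k = \<lfloor>real n * \<beta>\<rfloor>"
proof (cases "k = 0")
  case True
  then show ?thesis by (intro exI[of _ 0]) simp
next
  case False
  show ?thesis
  proof (rule ccontr)
    assume neg: "\<not> ?thesis"
    obtain n :: nat where n: "real n * \<alpha> < k" "real (Suc n) * \<alpha> \<ge> real k + 1"
      using floor_multiple_gap[of \<alpha> k] assms(1) False neg by (metis gr0I)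
    obtain m :: nat where m: "real m * \<beta> < k" "real (Suc m) * \<beta> \<ge> real k + 1"
      using floor_multiple_gap[of \<beta> k] assms(2) False neg by (metis gr0I)
    have "real (Suc n) * \<alpha> \<noteq> real k + 1"
      using irrat[of "Suc n" "int k + 1"] by simp
    then have n': "n < k / \<alpha>" "(real k + 1) / \<alpha> < real (Suc n)"
      using n assms(1) by (auto simp: field_simps)
    have m': "m < k / \<beta>" "(real k + 1) / \<beta> \<le> real (Suc m)"
      using m assms(2) by (auto simp: field_simps)
    have split: "x / \<alpha> + x / \<beta> = x" for x
      using arg_cong[OF inv, of "\<lambda>z. x * z"] by (simp add: distrib_left)
    have "real n + real m < k" "real k + 1 < real (Suc n) + real (Suc m)"
      using n' m' split[of k] split[of "real k + 1"] by linarith+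
    then have "n + m < k" "k + 1 < Suc n + Suc m"
      by linarith+
    then show False by linarith
  qed
qed

section \<open>The quadratic irrational\<close>

text \<open>A root q would lie strictly between t and t + 2, and q = t + 1 fails by parity.\<close>

lemma square_plus_4_not_square:
  fixes q t :: nat
  assumes "t > 0"
  shows "q\<^sup>2 \<noteq> t\<^sup>2 + 4"
proof
  assume q: "q\<^sup>2 = t\<^sup>2 + 4"
  then have "t\<^sup>2 < q\<^sup>2" by simp
  then have "t < q" by (rule power_less_imp_less_base) simp
  moreover have "q < t + 2"
  proof (rule power_less_imp_less_base)
    show "q\<^sup>2 < (t + 2)\<^sup>2"
      using q assms by (simp add: power2_eq_square algebra_simps)
  qed simp
  ultimately have "q = t + 1" by simp
  then have "2 * t + 1 = 4"
    using q by (simp add: power2_eq_square)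
  then show False by presburger
qed

lemma wythoff_root_irrational:
  fixes \<alpha> :: real and t n :: nat and k :: int
  assumes "t > 0" and root: "\<alpha>\<^sup>2 + (real t - 2) * \<alpha> = t" and "n > 0"
  shows "real n * \<alpha> \<noteq> of_int k"
proof
  assume k: "real n * \<alpha> = of_int k"
  \<comment> \<open>If n\<alpha> = k, then m / n = 2\<alpha> + t - 2, whose square is the
    discriminant (t - 2)^2 + 4t = t^2 + 4.\<close>
  define m where "m = 2 * k + (int t - 2) * int n"
  have "real_of_int (m\<^sup>2) = (2 * (real n * \<alpha>) + (real t - 2) * real n)\<^sup>2"
    by (simp add: m_def k)
  also have "\<dots> = (4 * (\<alpha>\<^sup>2 + (real t - 2) * \<alpha>) + (real t - 2)\<^sup>2) * (real n)\<^sup>2"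
    by (simp add: power2_eq_square algebra_simps)
  also have "\<dots> = real_of_int (int ((t\<^sup>2 + 4) * n\<^sup>2))"
    unfolding root by (simp add: power2_eq_square algebra_simps)
  finally have "m\<^sup>2 = int ((t\<^sup>2 + 4) * n\<^sup>2)"
    by (simp only: of_int_eq_iff)
  then have "int ((nat \<bar>m\<bar>)\<^sup>2) = int ((t\<^sup>2 + 4) * n\<^sup>2)"
    by simp
  then have sq: "(nat \<bar>m\<bar>)\<^sup>2 = (t\<^sup>2 + 4) * n\<^sup>2"
    by (simp only: of_nat_eq_iff)
  then have "n\<^sup>2 dvd (nat \<bar>m\<bar>)\<^sup>2" by simp
  then have "n dvd nat \<bar>m\<bar>" by simp
  then obtain q where "nat \<bar>m\<bar> = n * q" by (rule dvdE)
  with sq have "q\<^sup>2 = t\<^sup>2 + 4"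
    using assms(3) by (simp add: power_mult_distrib)
  then show False
    using square_plus_4_not_square[OF assms(1)] by blast
qed

text \<open>The larger root exceeds 1 because sqrt(t^2 + 4) > t.\<close>

lemma wythoff_root_exists:
  fixes t :: nat
  obtains \<alpha> :: real where "\<alpha> > 1" and "\<alpha>\<^sup>2 + (real t - 2) * \<alpha> = t"
proof
  define r where "r = sqrt ((real t)\<^sup>2 + 4)"
  have r2: "r * r = real t * real t + 4"
    by (simp add: r_def power2_eq_square)
  have "real t < r"
    unfolding r_def by (rule real_less_rsqrt) simp
  then show "(2 - real t + r) / 2 > 1" by simp
  show "((2 - real t + r) / 2)\<^sup>2 + (real t - 2) * ((2 - real t + r) / 2) = t"
    using r2 by (simp add: power2_eq_square field_simps)
qed

section \<open>The case s = 1\<close>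

lemma seqA_eq_floor:
  fixes \<alpha> :: real and t :: nat
  assumes "t > 0" and "\<alpha> > 1" and root: "\<alpha>\<^sup>2 + (real t - 2) * \<alpha> = t"
  shows "int (seqA 1 t n) = \<lfloor>real n * \<alpha>\<rfloor>"
proof -
  define \<beta> where "\<beta> = \<alpha> + real t"
  have pos: "\<alpha> > 0" "\<beta> > 0"
    using assms(2) by (auto simp: \<beta>_def)
  have inv: "1 / \<alpha> + 1 / \<beta> = 1"
    \<comment> \<open>Clearing denominators turns this identity into the quadratic equation
      \<open>root\<close>.\<close>
    using root pos by (simp add: \<beta>_def field_simps power2_eq_square)
  note irrat = wythoff_root_irrational[OF assms(1) root]
  define a where "a n = nat \<lfloor>real n * \<alpha>\<rfloor>" for n
  have a: "int (a n) = \<lfloor>real n * \<alpha>\<rfloor>" for n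
    using pos by (simp add: a_def)
  have b: "int (a n + t * n) = \<lfloor>real n * \<beta>\<rfloor>" for n
  proof -
    have "real n * \<beta> = real n * \<alpha> + of_int (int (t * n))"
      by (simp add: \<beta>_def algebra_simps)
    then show ?thesis
      by (simp only: floor_add_int[symmetric] of_nat_add a)
  qed
  have "strict_mono a"
  proof (rule strict_mono_Suc_iff[THEN iffD2], rule allI)
    fix n
    have "real n * \<alpha> + 1 \<le> real (Suc n) * \<alpha>"
      using assms(2) by (simp add: algebra_simps)
    then have "int (a n) < int (a (Suc n))"
      unfolding a by linarith
    then show "a n < a (Suc n)" by simp
  qed
  have "seqA 1 t n = a n"
  proof (induction n rule: less_induct)
    case (less n)
    let ?S = "{seqA 1 t i | i. i < n} \<union> {seqB 1 t i | i. i < n}"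
    have S: "?S = {a i | i. i < n} \<union> {a i + t * i | i. i < n}"
      using less by (force simp: seqB_def)
    have "mex ?S = a n"
      unfolding S
    proof (rule mex_eqI)
      have "a n \<noteq> a i" if "i < n" for i
        using strict_monoD[OF \<open>strict_mono a\<close> that] by simp
      moreover have "a n \<noteq> a i + t * i" if "i < n" for i
        \<comment> \<open>Here i < n supplies n > 0, which irrationality of n\<alpha>
          requires.\<close>
        using beatty_disjoint[OF pos inv irrat, of n i] that a[of n] b[of i] by auto
      ultimately show "a n \<notin> {a i | i. i < n} \<union> {a i + t * i | i. i < n}"
        by blast
    next
      fix j assume j: "j < a n"
      obtain i where i: "j = a i \<or> j = a i + t * i"
        using beatty_cover[OF pos inv irrat, of j] unfolding a[symmetric] b[symmetric]
        by (auto simp only: of_nat_eq_iff)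
      \<comment> \<open>In either case a i \<le> j < a n, so monotonicity makes the covering index
        an earlier one.\<close>
      then have "a i < a n" using j by auto
      then have "i < n" using \<open>strict_mono a\<close> by (simp add: strict_mono_less)
      then show "j \<in> {a i | i. i < n} \<union> {a i + t * i | i. i < n}"
        using i by blast
    qed
    then show ?case by (subst seqA_eq)
  qed
  then show ?thesis by (simp add: a)
qed

theorem theorem2:
  fixes s t :: nat
  assumes "s > 0" and "t > 0"
  shows "(\<exists>\<alpha> \<gamma> \<beta> \<delta> :: real.
            \<forall>n. int (seqA s t n) = \<lfloor>real n * \<alpha> + \<gamma>\<rfloor> \<and>
                int (seqB s t n) = \<lfloor>real n * \<beta> + \<delta>\<rfloor>)
         \<longleftrightarrow> s = 1"
proof
  assume "\<exists>\<alpha> \<gamma> \<beta> \<delta> :: real.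
            \<forall>n. int (seqA s t n) = \<lfloor>real n * \<alpha> + \<gamma>\<rfloor> \<and>
                int (seqB s t n) = \<lfloor>real n * \<beta> + \<delta>\<rfloor>"
  then have "\<not> s \<ge> 2"
    using seqB_not_floor_linear by blast
  then show "s = 1" using assms(1) by simp
next
  assume s: "s = 1"
  obtain \<alpha> :: real where \<alpha>: "\<alpha> > 1" "\<alpha>\<^sup>2 + (real t - 2) * \<alpha> = t"
    by (rule wythoff_root_exists)
  note A = seqA_eq_floor[OF assms(2) \<alpha>]
  have "int (seqB 1 t n) = \<lfloor>real n * (\<alpha> + real t)\<rfloor>" for n
  proof -
    have "real n * (\<alpha> + real t) = real n * \<alpha> + of_int (int (t * n))"
      by (simp add: algebra_simps)
    then show ?thesis
      by (simp only: floor_add_int[symmetric] seqB_def of_nat_add A mult_1)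
  qed
  \<comment> \<open>Witnesses: slopes \<alpha> and \<alpha> + t, both offsets 0.\<close>
  then show "\<exists>\<alpha> \<gamma> \<beta> \<delta> :: real.
            \<forall>n. int (seqA s t n) = \<lfloor>real n * \<alpha> + \<gamma>\<rfloor> \<and>
                int (seqB s t n) = \<lfloor>real n * \<beta> + \<delta>\<rfloor>"
    unfolding s using A
    by (intro exI[of _ \<alpha>] exI[of _ "0::real"] exI[of _ "\<alpha> + real t"]) simp
qed

end
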